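(* Let $d$ be a metric on the parameter space $S$ and $\eta_0\in S$ the true parameter. Suppose that there exist universal constants $K,a>0$ such that for all $\varepsilon>0$ and all $\eta_1\in S$ satisfying $d(\eta_0,\eta_1)>\varepsilon$, there exist tests $\varphi_n$ satisfying $$E_{\eta_0}\varphi_n\le e^{-Kn\varepsilon^2},\qquad\sup_{\eta\in S:\,d(\eta,\eta_1)<a\varepsilon}E_\eta(1-\varphi_n)\le e^{-Kn\varepsilon^2}.$$ Let $\Pi=\Pi_n$ be a prior on $S$, and let $\varepsilon_n,\tilde\varepsilon_n$ and $0<\alpha_n\le1$ be nonnegative sequences such that $n\alpha_n\tilde\varepsilon_n^2\to\infty$. Suppose further that there exist constants $C,D>0$ and subsets $S_n\subset S$ satisfying 1. $N(\varepsilon_n,S_n,d)\le e^{Dn\varepsilon_n^2}$, 2. $\Pi(S_n^c)\le e^{-(C+3)n\alpha_n\tilde\varepsilon_n^2}$, 3. $\Pi(B_n(\eta_0,\tilde\varepsilon_n))\ge e^{-Cn\alpha_n\tilde\varepsilon_n^2}$. Then there exists $M>0$ such that, as $n\to\infty$, $$\Pi_{\alpha_n}\big(\eta:d(\eta,\eta_0)\ge M(\varepsilon_n\vee\tilde\varepsilon_n)\mid Y^n\big)\to0\quad\text{in }P_0\text{-probability}.$$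
   Context: $(\mathcal Y^n,\mathcal A^n,P^n_\eta:\eta\in S)$ is a sequence of statistical experiments with observation $Y^n$ and densities $p^n_\eta$ with respect to a $\sigma$-finite measure $\mu^n$; $E_\eta$ is expectation under $P^n_\eta$; $P_0=P^n_{\eta_0}$. A test $\varphi_n$ is a measurable function of $Y^n$ with values in $[0,1]$. The $\alpha_n$-posterior is $\Pi_{\alpha_n}(B\mid Y^n)=\int_B(p^n_\eta(Y^n))^{\alpha_n}d\Pi(\eta)/\int_S(p^n_\eta(Y^n))^{\alpha_n}d\Pi(\eta)$. $N(\varepsilon,A,d)$ is the minimal number of $d$-balls of radius $\varepsilon$ needed to cover $A$. $K(f,g)=\int f\log(f/g)\,d\mu$ (Kullback–Leibler divergence, not to be confused with the constant $K$), $V(f,g)=\int f(\log(f/g)-K(f,g))^2d\mu$, and $B_n(\eta_0,\varepsilon)=\{\eta\in S:K(p^n_{\eta_0},p^n_\eta)\le n\varepsilon^2,\ V(p^n_{\eta_0},p^n_\eta)\le n\varepsilon^2\}$. *)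

theory Defs
  imports "HOL-Probability.Probability"
begin

abbreviation law :: "'y measure \<Rightarrow> ('y \<Rightarrow> real) \<Rightarrow> 'y measure" where
  "law \<mu> f \<equiv> density \<mu> (\<lambda>y. ennreal (f y))"

definition statistical_experiment ::
  "'p set \<Rightarrow> 'y measure \<Rightarrow> ('p \<Rightarrow> 'y \<Rightarrow> real) \<Rightarrow> bool" where
  "statistical_experiment S \<mu> p \<longleftrightarrow> sigma_finite_measure \<mu> \<and>
     (\<forall>\<eta>\<in>S. p \<eta> \<in> borel_measurable \<mu> \<and> (\<forall>y\<in>space \<mu>. 0 \<le> p \<eta> y) \<and>
             prob_space (law \<mu> (p \<eta>)))"

(* The sigma-algebra of the parameter space is the one carried by the prior. Joint measurability
   of the densities makes the posterior a well-defined random variable. *)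
definition prior_for ::
  "'p set \<Rightarrow> 'y measure \<Rightarrow> ('p \<Rightarrow> 'y \<Rightarrow> real) \<Rightarrow> 'p measure \<Rightarrow> bool" where
  "prior_for S \<mu> p \<pi> \<longleftrightarrow> prob_space \<pi> \<and> space \<pi> = S \<and>
     (\<lambda>(\<eta>, y). p \<eta> y) \<in> borel_measurable (\<pi> \<Otimes>\<^sub>M \<mu>)"

definition is_test :: "'y measure \<Rightarrow> ('y \<Rightarrow> real) \<Rightarrow> bool" where
  "is_test \<mu> \<phi> \<longleftrightarrow> \<phi> \<in> borel_measurable \<mu> \<and> (\<forall>y\<in>space \<mu>. 0 \<le> \<phi> y \<and> \<phi> y \<le> 1)"

(* If the normalising integral is 0 or infinite, the quotient is 0 by the ennreal conventions. *)
definition alpha_posterior ::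
  "real \<Rightarrow> 'p measure \<Rightarrow> ('p \<Rightarrow> 'y \<Rightarrow> real) \<Rightarrow> 'y \<Rightarrow> 'p set \<Rightarrow> ennreal" where
  "alpha_posterior \<alpha> \<pi> p y B =
     (\<integral>\<^sup>+\<eta>\<in>B. ennreal (p \<eta> y powr \<alpha>) \<partial>\<pi>) / (\<integral>\<^sup>+\<eta>. ennreal (p \<eta> y powr \<alpha>) \<partial>\<pi>)"

(* Open balls with centres in S; the value is infinity if there is no finite cover. *)
definition covering_number ::
  "'p set \<Rightarrow> ('p \<Rightarrow> 'p \<Rightarrow> real) \<Rightarrow> real \<Rightarrow> 'p set \<Rightarrow> enat" where
  "covering_number S d \<epsilon> A =
     (INF X \<in> {X. finite X \<and> X \<subseteq> S \<and> A \<subseteq> (\<Union>x\<in>X. Metric_space.mball S d x \<epsilon>)}. enat (card X))"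

(* Lebesgue integral of an extended-real function (ereal-valued integrands are not covered by the
   Bochner integral); e2ennreal truncates negative values to 0. *)
definition ereal_integral :: "'y measure \<Rightarrow> ('y \<Rightarrow> ereal) \<Rightarrow> ereal" where
  "ereal_integral \<mu> h =
     enn2ereal (\<integral>\<^sup>+y. e2ennreal (h y) \<partial>\<mu>) - enn2ereal (\<integral>\<^sup>+y. e2ennreal (- h y) \<partial>\<mu>)"

(* log(u/0) = \<infinity>. The value is only relevant for u > 0, since it is always multiplied by u below
   and 0 * \<infinity> = 0 in ereal. *)
definition log_ratio :: "real \<Rightarrow> real \<Rightarrow> ereal" where
  "log_ratio u v = (if v = 0 then \<infinity> else ereal (ln (u / v)))"

(* KL_divergence of HOL-Probability is a Bochner integral of a real function, hence never
   infinite: it does not detect a failure of absolute continuity or of integrability. *)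
definition KL :: "'y measure \<Rightarrow> ('y \<Rightarrow> real) \<Rightarrow> ('y \<Rightarrow> real) \<Rightarrow> ereal" where
  "KL \<mu> f g = ereal_integral \<mu> (\<lambda>y. ereal (f y) * log_ratio (f y) (g y))"

(* \<infinity> - \<infinity> = \<infinity> in ereal, so the value is \<infinity> whenever KL \<mu> f g = \<infinity>. *)
definition KL_variation :: "'y measure \<Rightarrow> ('y \<Rightarrow> real) \<Rightarrow> ('y \<Rightarrow> real) \<Rightarrow> ereal" where
  "KL_variation \<mu> f g =
     ereal_integral \<mu> (\<lambda>y. ereal (f y) * (log_ratio (f y) (g y) - KL \<mu> f g)\<^sup>2)"

definition KL_nbhd ::
  "'p set \<Rightarrow> 'y measure \<Rightarrow> ('p \<Rightarrow> 'y \<Rightarrow> real) \<Rightarrow> nat \<Rightarrow> 'p \<Rightarrow> real \<Rightarrow> 'p set" where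
  "KL_nbhd S \<mu> p n \<eta>0 \<epsilon> =
     {\<eta>\<in>S. KL \<mu> (p \<eta>0) (p \<eta>) \<le> ereal (real n * \<epsilon>\<^sup>2) \<and>
            KL_variation \<mu> (p \<eta>0) (p \<eta>) \<le> ereal (real n * \<epsilon>\<^sup>2)}"

definition tendsto_zero_in_prob :: "(nat \<Rightarrow> 'y measure) \<Rightarrow> (nat \<Rightarrow> 'y \<Rightarrow> ennreal) \<Rightarrow> bool" where
  "tendsto_zero_in_prob P X \<longleftrightarrow>
     (\<forall>\<delta>::real. \<delta> > 0 \<longrightarrow>
        (\<lambda>n. measure (P n) {y\<in>space (P n). X n y > ennreal \<delta>}) \<longlonglongrightarrow> 0)"

end

(* Let b be large and r = max eps eps', and cover the sieve by N(eps) balls. Every ball that meets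
   {d >= (b + 1) r} has its centre at distance > b r from eta0, so the union of the rejection
   regions of the tests attached to these centres is an event U that is unlikely under eta0, while
   its complement is unlikely, at rate exp (- K b^2 n r^2), under every eta of the sieve with
   d eta eta0 >= (b + 1) r. By Young's inequality the alpha-th power of the likelihood ratio turns
   this rate into exp (- alpha K b^2 n r^2) outside U, which beats the evidence: by Chebyshev's
   inequality and Fubini the normalising integral is, with high probability, at least
   exp (- (C + 2) n alpha eps'^2) / 2. *)

theory Submission
  imports Defs
begin


section \<open>Fractional powers of the likelihood ratio\<close>

lemma powr_le_affine:
  fixes x \<alpha> :: real
  assumes "0 \<le> x" "0 < \<alpha>" "\<alpha> \<le> 1"
  shows "x powr \<alpha> \<le> 1 - \<alpha> + \<alpha> * x"
  using Youngs_inequality_0[of "1 - \<alpha>" \<alpha> 1 x] assms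
  by (cases "x = 0") auto

text \<open>The power is bounded by its tangent at \<open>Q\<close> instead of at 1. After
  integration the constant part contributes at most \<open>1 - \<alpha>\<close>, and the linear part
  at most \<open>\<alpha>\<close>, since \<open>g\<close> has mass at most \<open>Q\<close> on
  \<open>V\<close>; the prefactor \<open>Q powr \<alpha>\<close> remains.\<close>

lemma nn_integral_likelihood_ratio_powr_le:
  fixes f g :: "'y \<Rightarrow> real"
  assumes f[measurable]: "f \<in> borel_measurable \<mu>" and g[measurable]: "g \<in> borel_measurable \<mu>"
    and f_nonneg: "\<And>y. y \<in> space \<mu> \<Longrightarrow> 0 \<le> f y" and g_nonneg: "\<And>y. y \<in> space \<mu> \<Longrightarrow> 0 \<le> g y"
    and "prob_space (law \<mu> f)" and V[measurable]: "V \<in> sets \<mu>"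
    and mass: "emeasure (law \<mu> g) V \<le> ennreal Q" and "0 < Q" and \<alpha>: "0 < \<alpha>" "\<alpha> \<le> 1"
  shows "(\<integral>\<^sup>+y\<in>V. ennreal ((g y / f y) powr \<alpha>) \<partial>law \<mu> f) \<le> ennreal (Q powr \<alpha>)"
proof -
  interpret P: prob_space "law \<mu> f" by fact
  \<comment> \<open>Multiplying by \<open>f\<close> makes both sides densities with respect to
    \<open>\<mu>\<close>. Where \<open>f\<close> vanishes the left side is 0, and the
    \<open>g\<close>-term on the right absorbs the part of \<open>g\<close> singular to
    \<open>f\<close>.\<close>
  have pointwise: "f y * (g y / f y) powr \<alpha> \<le> Q powr \<alpha> * ((1 - \<alpha>) * f y + \<alpha> / Q * g y)"
    if "y \<in> space \<mu>" for y
  proof (cases "f y = 0")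
    case True
    then show ?thesis using g_nonneg[OF that] \<open>0 < Q\<close> \<alpha> by simp
  next
    case False
    then have "0 < f y" using f_nonneg[OF that] by simp
    define u where "u = g y / (f y * Q)"
    have "0 \<le> u" using g_nonneg[OF that] \<open>0 < f y\<close> \<open>0 < Q\<close> by (simp add: u_def)
    have "(g y / f y) powr \<alpha> = (Q * u) powr \<alpha>" using \<open>0 < Q\<close> by (simp add: u_def)
    also have "\<dots> = Q powr \<alpha> * u powr \<alpha>" using \<open>0 < Q\<close> \<open>0 \<le> u\<close> by (simp add: powr_mult)
    also have "\<dots> \<le> Q powr \<alpha> * (1 - \<alpha> + \<alpha> * u)"
      using powr_le_affine[OF \<open>0 \<le> u\<close> \<alpha>] by (intro mult_left_mono) auto
    finally have "f y * (g y / f y) powr \<alpha> \<le> f y * (Q powr \<alpha> * (1 - \<alpha> + \<alpha> * u))"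
      using \<open>0 < f y\<close> by (intro mult_left_mono) auto
    also have "\<dots> = Q powr \<alpha> * ((1 - \<alpha>) * f y + \<alpha> / Q * g y)"
      using \<open>0 < f y\<close> \<open>0 < Q\<close> by (simp add: u_def field_simps)
    finally show ?thesis .
  qed
  have "(\<integral>\<^sup>+y\<in>V. ennreal ((g y / f y) powr \<alpha>) \<partial>law \<mu> f)
      = (\<integral>\<^sup>+y. ennreal (f y * (g y / f y) powr \<alpha>) * indicator V y \<partial>\<mu>)"
    using f_nonneg by (subst nn_integral_density) (auto intro!: nn_integral_cong simp: ennreal_mult mult.assoc)
  also have "\<dots> \<le> (\<integral>\<^sup>+y. ennreal (Q powr \<alpha>) * (ennreal (1 - \<alpha>) * (ennreal (f y) * indicator V y)
        + ennreal (\<alpha> / Q) * (ennreal (g y) * indicator V y)) \<partial>\<mu>)"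
    using pointwise f_nonneg g_nonneg \<alpha> \<open>0 < Q\<close>
    by (intro nn_integral_mono) (auto split: split_indicator simp flip: ennreal_mult ennreal_plus intro!: ennreal_leI)
  also have "\<dots> = ennreal (Q powr \<alpha>) * (ennreal (1 - \<alpha>) * emeasure (law \<mu> f) V
        + ennreal (\<alpha> / Q) * emeasure (law \<mu> g) V)"
    by (simp add: nn_integral_cmult nn_integral_add emeasure_density)
  also have "\<dots> \<le> ennreal (Q powr \<alpha>) * (ennreal (1 - \<alpha>) * 1 + ennreal (\<alpha> / Q) * ennreal Q)"
    using mass P.emeasure_le_1 by (intro mult_left_mono add_mono) auto
  also have "\<dots> = ennreal (Q powr \<alpha>)"
    using \<open>0 < Q\<close> \<alpha> by (simp flip: ennreal_mult ennreal_plus)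
  finally show ?thesis .
qed

section \<open>Lower bounds for the evidence\<close>

text \<open>Chebyshev's inequality for the log-likelihood ratio. Nothing about \<open>KL\<close> being finite from
  below is needed: were it \<open>-\<infinity>\<close>, the squared deviation would be infinite.\<close>

lemma KL_lower_tail:
  assumes f[measurable]: "f \<in> borel_measurable \<mu>" and g[measurable]: "g \<in> borel_measurable \<mu>"
    and f_nonneg: "\<And>y. y \<in> space \<mu> \<Longrightarrow> 0 \<le> f y" and g_nonneg: "\<And>y. y \<in> space \<mu> \<Longrightarrow> 0 \<le> g y"
    and "0 < t" and KL: "KL \<mu> f g \<le> ereal t" and V: "KL_variation \<mu> f g \<le> ereal t"
  shows "emeasure (law \<mu> f) {y \<in> space \<mu>. g y / f y < exp (- (2 * t))} \<le> ennreal (1 / t)"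
proof -
  define E where "E = {y \<in> space \<mu>. g y / f y < exp (- (2 * t))}"
  define h where "h y = ereal (f y) * (log_ratio (f y) (g y) - KL \<mu> f g)\<^sup>2" for y
  have E[measurable]: "E \<in> sets \<mu>" by (simp add: E_def)
  have square_ge: "ereal (t\<^sup>2) \<le> x\<^sup>2" if "ereal t \<le> x" for x
    using that \<open>0 < t\<close> by (cases x) (auto simp: power2_eq_square mult_mono)
  have square_nonneg: "0 \<le> x\<^sup>2" for x :: ereal
    by (cases x) (auto simp: power2_eq_square)
  have h_nonneg: "0 \<le> h y" if "y \<in> space \<mu>" for y
    using f_nonneg[OF that] square_nonneg by (simp add: h_def)
  \<comment> \<open>Chebyshev's inequality before integration. Outside \<open>E\<close> and at zeros
    of \<open>f\<close> the left side is 0; elsewhere the squared deviation is at least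
    \<open>t\<^sup>2\<close>.\<close>
  have pointwise: "ennreal (t\<^sup>2) * (ennreal (f y) * indicator E y) \<le> e2ennreal (h y)"
    if y: "y \<in> space \<mu>" for y
  proof (cases "y \<in> E \<and> f y \<noteq> 0")
    case True
    then have "0 < f y" using f_nonneg[OF y] by simp
    have lr: "ereal (2 * t) \<le> log_ratio (f y) (g y)"
    proof (cases "g y = 0")
      case False
      then have "0 < g y" using g_nonneg[OF y] by simp
      have "ln (g y / f y) < ln (exp (- (2 * t)))"
        using True \<open>0 < f y\<close> \<open>0 < g y\<close> by (subst ln_less_cancel_iff) (auto simp: E_def)
      then show ?thesis
        using \<open>0 < f y\<close> \<open>0 < g y\<close> by (simp add: log_ratio_def ln_div)
    qed (simp add: log_ratio_def)
    \<comment> \<open>The threshold \<open>2 * t\<close> is chosen for this step: the divergence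
      uses up at most \<open>t\<close> of it, and a deviation of \<open>t\<close> from the mean
      remains.\<close>
    have "ereal t \<le> log_ratio (f y) (g y) - KL \<mu> f g"
      using ereal_minus_mono[OF lr KL] by simp
    then have "ereal (f y) * ereal (t\<^sup>2) \<le> h y"
      using \<open>0 < f y\<close> unfolding h_def by (intro ereal_mult_left_mono square_ge) auto
    then have "e2ennreal (ereal (f y * t\<^sup>2)) \<le> e2ennreal (h y)"
      by (intro e2ennreal_mono) simp
    then show ?thesis using True \<open>0 < f y\<close> by (simp add: mult.commute flip: ennreal_mult)
  qed (auto split: split_indicator)
  define A where "A = (\<integral>\<^sup>+y. e2ennreal (h y) \<partial>\<mu>)"
  \<comment> \<open>The subtracted negative part in \<open>ereal_integral\<close> vanishes because
    \<open>h\<close> is nonnegative, so the variation bound is a bound on \<open>A\<close>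
    itself.\<close>
  have "(\<integral>\<^sup>+y. e2ennreal (- h y) \<partial>\<mu>) = (\<integral>\<^sup>+y. 0 \<partial>\<mu>)"
    using h_nonneg by (intro nn_integral_cong e2ennreal_neg) simp
  then have "enn2ereal A \<le> ereal t"
    using V by (simp add: KL_variation_def ereal_integral_def A_def h_def zero_ennreal.rep_eq)
  then have A: "A \<le> ennreal t"
    using e2ennreal_mono by fastforce
  have "ennreal (t\<^sup>2) * emeasure (law \<mu> f) E = (\<integral>\<^sup>+y. ennreal (t\<^sup>2) * (ennreal (f y) * indicator E y) \<partial>\<mu>)"
    by (simp add: nn_integral_cmult emeasure_density)
  also have "\<dots> \<le> A"
    unfolding A_def using pointwise by (intro nn_integral_mono) auto
  finally have "ennreal (1 / t\<^sup>2) * (ennreal (t\<^sup>2) * emeasure (law \<mu> f) E) \<le> ennreal (1 / t\<^sup>2) * ennreal t"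
    using A by (intro mult_left_mono) auto
  then show ?thesis
    using \<open>0 < t\<close> by (simp add: E_def mult.assoc[symmetric] power2_eq_square flip: ennreal_mult)
qed

text \<open>Replaces the usual Jensen argument, which would need joint integrability of the
  log-likelihood ratio: Fubini and Markov's inequality keep half of the mass of \<open>B\<close>.\<close>

lemma evidence_lower_bound:
  fixes u :: "'p \<Rightarrow> 'y \<Rightarrow> real"
  assumes "prob_space P" "prob_space \<pi>"
    and u[measurable]: "case_prod u \<in> borel_measurable (\<pi> \<Otimes>\<^sub>M P)" and B[measurable]: "B \<in> sets \<pi>"
    and B_pos: "0 < measure \<pi> B" and "0 \<le> \<beta>" "0 < t" "0 < \<alpha>"
    and tail: "\<And>\<eta>. \<eta> \<in> B \<Longrightarrow> emeasure P {y \<in> space P. u \<eta> y < t} \<le> ennreal \<beta>"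
  obtains G where "G \<in> sets P" "emeasure P G \<le> ennreal (2 * \<beta>)"
    "\<And>y. y \<in> space P - G \<Longrightarrow>
      ennreal (t powr \<alpha> * measure \<pi> B / 2) \<le> (\<integral>\<^sup>+\<eta>. ennreal (u \<eta> y powr \<alpha>) \<partial>\<pi>)"
proof -
  interpret P: prob_space P by fact
  interpret \<pi>: prob_space \<pi> by fact
  interpret pair_sigma_finite \<pi> P ..
  define m where "m = measure \<pi> B"
  define low where "low \<eta> y = (if \<eta> \<in> B \<and> u \<eta> y < t then 1 else 0 :: ennreal)" for \<eta> y
  \<comment> \<open>Up to the factor \<open>2 / m\<close>, this is the set of observations at which
    at least half of the prior mass of \<open>B\<close> has a likelihood ratio below
    \<open>t\<close>.\<close>
  define G where "G = {y \<in> space P. 1 \<le> ennreal (2 / m) * (\<integral>\<^sup>+\<eta>. low \<eta> y \<partial>\<pi>)}"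
  have "0 < m" using B_pos by (simp add: m_def)
  have m: "emeasure \<pi> B = ennreal m" by (simp add: m_def \<pi>.emeasure_eq_measure)
  have low[measurable]: "case_prod low \<in> borel_measurable (\<pi> \<Otimes>\<^sub>M P)"
    unfolding low_def by measurable
  have [measurable]: "(\<lambda>y. \<integral>\<^sup>+\<eta>. low \<eta> y \<partial>\<pi>) \<in> borel_measurable P"
    using measurable_pair_swap[OF low]
    by (intro \<pi>.borel_measurable_nn_integral) (simp add: case_prod_beta')
  have "G \<in> sets P" by (simp add: G_def)
  have slice: "(\<integral>\<^sup>+y. low \<eta> y \<partial>P) \<le> ennreal \<beta> * indicator B \<eta>" if \<eta>: "\<eta> \<in> space \<pi>" for \<eta>
  proof (cases "\<eta> \<in> B")
    case True
    have [measurable]: "u \<eta> \<in> borel_measurable P"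
      using measurable_Pair2[OF u \<eta>] by simp
    have "(\<integral>\<^sup>+y. low \<eta> y \<partial>P) = (\<integral>\<^sup>+y. indicator {y \<in> space P. u \<eta> y < t} y \<partial>P)"
      using True by (intro nn_integral_cong) (auto simp: low_def)
    also have "\<dots> = emeasure P {y \<in> space P. u \<eta> y < t}"
      by (intro nn_integral_indicator) measurable
    finally show ?thesis using tail[OF True] True by simp
  qed (simp add: low_def)
  have "emeasure P G \<le> ennreal (2 / m) * (\<integral>\<^sup>+y. (\<integral>\<^sup>+\<eta>. low \<eta> y \<partial>\<pi>) * indicator (space P) y \<partial>P)"
    unfolding G_def by (intro nn_integral_Markov_inequality) auto
  also have "(\<integral>\<^sup>+y. (\<integral>\<^sup>+\<eta>. low \<eta> y \<partial>\<pi>) * indicator (space P) y \<partial>P) = (\<integral>\<^sup>+y. (\<integral>\<^sup>+\<eta>. low \<eta> y \<partial>\<pi>) \<partial>P)"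
    by (intro nn_integral_cong) auto
  \<comment> \<open>The tail bound holds for each fixed parameter, so the observation has to be
    integrated out first.\<close>
  also have "\<dots> = (\<integral>\<^sup>+\<eta>. (\<integral>\<^sup>+y. low \<eta> y \<partial>P) \<partial>\<pi>)"
    using Fubini'[of low] by (simp add: low)
  also have "\<dots> \<le> (\<integral>\<^sup>+\<eta>. ennreal \<beta> * indicator B \<eta> \<partial>\<pi>)"
    by (intro nn_integral_mono slice)
  also have "\<dots> = ennreal \<beta> * ennreal m" by (simp add: nn_integral_cmult_indicator m)
  finally have "emeasure P G \<le> ennreal (2 / m) * (ennreal \<beta> * ennreal m)"
    by (simp add: mult_left_mono)
  also have "\<dots> = ennreal (2 * \<beta>)"
    using \<open>0 < m\<close> \<open>0 \<le> \<beta>\<close> by (simp flip: ennreal_mult)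
  finally have G: "emeasure P G \<le> ennreal (2 * \<beta>)" .
  show thesis
  proof (rule that[OF \<open>G \<in> sets P\<close> G])
    fix y assume y: "y \<in> space P - G"
    then have [measurable]: "(\<lambda>\<eta>. u \<eta> y) \<in> borel_measurable \<pi>" 
      using measurable_Pair1[OF u, of y] by simp
    \<comment> \<open>Off \<open>G\<close> the bad slice \<open>H\<close> has mass below
      \<open>m / 2\<close>, so \<open>B - H\<close> keeps half of \<open>B\<close>, and the ratio is
      at least \<open>t\<close> there.\<close>
    define H where "H = {\<eta> \<in> space \<pi>. \<eta> \<in> B \<and> u \<eta> y < t}"
    have [measurable]: "H \<in> sets \<pi>" unfolding H_def by measurable
    have "H \<subseteq> B" by (auto simp: H_def)
    have "(\<integral>\<^sup>+\<eta>. low \<eta> y \<partial>\<pi>) = (\<integral>\<^sup>+\<eta>. indicator H \<eta> \<partial>\<pi>)"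
      by (intro nn_integral_cong) (auto simp: low_def H_def)
    then have "ennreal (2 / m) * ennreal (measure \<pi> H) < 1"
      using y by (auto simp: G_def \<pi>.emeasure_eq_measure)
    then have "measure \<pi> H \<le> m / 2"
      using \<open>0 < m\<close> by (simp add: field_simps flip: ennreal_mult)
    then have "m / 2 \<le> measure \<pi> (B - H)"
      using \<open>H \<subseteq> B\<close> by (simp add: \<pi>.finite_measure_Diff m_def)
    then have "ennreal (t powr \<alpha> * measure \<pi> B / 2) \<le> ennreal (t powr \<alpha>) * emeasure \<pi> (B - H)"
      using mult_left_mono[of "m / 2" "measure \<pi> (B - H)" "t powr \<alpha>"]
      by (simp add: \<pi>.emeasure_eq_measure m_def flip: ennreal_mult)
    also have "\<dots> = (\<integral>\<^sup>+\<eta>. ennreal (t powr \<alpha>) * indicator (B - H) \<eta> \<partial>\<pi>)"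
      by (simp add: nn_integral_cmult_indicator)
    also have "\<dots> \<le> (\<integral>\<^sup>+\<eta>. ennreal (u \<eta> y powr \<alpha>) \<partial>\<pi>)"
      using \<open>0 < t\<close> \<open>0 < \<alpha>\<close>
      by (intro nn_integral_mono) (auto simp: H_def split: split_indicator intro!: ennreal_leI powr_mono2)
    finally show "ennreal (t powr \<alpha> * measure \<pi> B / 2) \<le> (\<integral>\<^sup>+\<eta>. ennreal (u \<eta> y powr \<alpha>) \<partial>\<pi>)" .
  qed
qed

section \<open>Covers and the event built from the tests\<close>

lemma covering_number_le_cover:
  assumes "ereal_of_enat (covering_number S d \<epsilon> A) \<le> ereal N"
  obtains X where "finite X" "X \<subseteq> S" "A \<subseteq> (\<Union>x\<in>X. Metric_space.mball S d x \<epsilon>)" "real (card X) \<le> N"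
proof -
  obtain k where k: "covering_number S d \<epsilon> A = enat k" "real k \<le> N"
    using assms by (cases "covering_number S d \<epsilon> A") auto
  \<comment> \<open>An infimum over \<open>enat\<close> that is finite is attained; the strict
    comparison with \<open>Suc k\<close> lets \<open>INF_less_iff\<close> produce the cover.\<close>
  then have "covering_number S d \<epsilon> A < enat (Suc k)" by simp
  then obtain X where "finite X" "X \<subseteq> S" "A \<subseteq> (\<Union>x\<in>X. Metric_space.mball S d x \<epsilon>)" "card X < Suc k"
    unfolding covering_number_def INF_less_iff by auto
  then show thesis using k(2) by (intro that[of X]) auto
qed

text \<open>Only the centres whose balls meet \<open>{\<eta>. d \<eta> \<eta>0 \<ge> e + r}\<close> matter, and these are at
  distance more than \<open>e\<close> from \<open>\<eta>0\<close>. Since \<open>r \<le> a * e\<close>, the whole \<open>r\<close>-ball is covered by the test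
  attached to its centre, so that no peeling into shells is needed.\<close>

lemma separating_event:
  assumes model: "statistical_experiment S \<mu> p" and metric: "Metric_space S d"
    and \<eta>0: "\<eta>0 \<in> S" and "0 < e" "0 < a" and r: "r \<le> a * e" and "0 \<le> q"
    and tests: "\<And>\<eta>1. \<lbrakk>\<eta>1 \<in> S; d \<eta>0 \<eta>1 > e\<rbrakk> \<Longrightarrow> \<exists>\<phi>. is_test \<mu> \<phi> \<and>
        (\<integral>y. \<phi> y \<partial>law \<mu> (p \<eta>0)) \<le> q \<and>
        (SUP \<eta>\<in>{\<eta>\<in>S. d \<eta> \<eta>1 < a * e}. \<integral>y. (1 - \<phi> y) \<partial>law \<mu> (p \<eta>)) \<le> q"
    and entropy: "ereal_of_enat (covering_number S d r T) \<le> ereal N"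
  obtains U where "U \<in> sets \<mu>" "measure (law \<mu> (p \<eta>0)) U \<le> 2 * N * q"
    "\<And>\<eta>. \<lbrakk>\<eta> \<in> T; d \<eta> \<eta>0 \<ge> e + r\<rbrakk> \<Longrightarrow> measure (law \<mu> (p \<eta>)) (space \<mu> - U) \<le> 2 * q"
proof -
  interpret Metric_space S d by fact
  have prob: "prob_space (law \<mu> (p \<eta>))" if "\<eta> \<in> S" for \<eta>
    using model that by (auto simp: statistical_experiment_def)
  obtain X where X: "finite X" "X \<subseteq> S" "T \<subseteq> (\<Union>x\<in>X. mball x r)" "real (card X) \<le> N"
    using covering_number_le_cover[OF entropy] by blast
  define X' where "X' = {x \<in> X. d \<eta>0 x > e}"
  have "finite X'" using X(1) by (simp add: X'_def)
  have "card X' \<le> card X" using X(1) by (intro card_mono) (auto simp: X'_def)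
  have "\<exists>\<phi>. \<forall>x\<in>X'. is_test \<mu> (\<phi> x) \<and> (\<integral>y. \<phi> x y \<partial>law \<mu> (p \<eta>0)) \<le> q \<and>
      (SUP \<eta>\<in>{\<eta>\<in>S. d \<eta> x < a * e}. \<integral>y. (1 - \<phi> x y) \<partial>law \<mu> (p \<eta>)) \<le> q"
    using X(2) by (intro bchoice ballI tests) (auto simp: X'_def)
  then obtain \<phi> where \<phi>: "\<And>x. x \<in> X' \<Longrightarrow> is_test \<mu> (\<phi> x)"
      "\<And>x. x \<in> X' \<Longrightarrow> (\<integral>y. \<phi> x y \<partial>law \<mu> (p \<eta>0)) \<le> q"
      "\<And>x. x \<in> X' \<Longrightarrow> (SUP \<eta>\<in>{\<eta>\<in>S. d \<eta> x < a * e}. \<integral>y. (1 - \<phi> x y) \<partial>law \<mu> (p \<eta>)) \<le> q"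
    by blast
  have \<phi>_meas[measurable]: "\<phi> x \<in> borel_measurable \<mu>" if "x \<in> X'" for x
    using \<phi>(1)[OF that] by (simp add: is_test_def)
  have \<phi>_range: "0 \<le> \<phi> x y" "\<phi> x y \<le> 1" if "x \<in> X'" "y \<in> space \<mu>" for x y
    using \<phi>(1)[OF that(1)] that(2) by (auto simp: is_test_def)
  have \<phi>_integrable: "integrable (law \<mu> (p \<eta>)) (\<phi> x)" "integrable (law \<mu> (p \<eta>)) (\<lambda>y. 1 - \<phi> x y)"
    if "\<eta> \<in> S" "x \<in> X'" for x \<eta>
  proof -
    interpret Q: prob_space "law \<mu> (p \<eta>)" by (rule prob) fact
    show *: "integrable (law \<mu> (p \<eta>)) (\<phi> x)"
      using \<phi>_range[OF that(2)] \<phi>_meas[OF that(2)] by (intro Q.integrable_const_bound[where B = 1] AE_I2) auto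
    show "integrable (law \<mu> (p \<eta>)) (\<lambda>y. 1 - \<phi> x y)"
      using * by simp
  qed
  \<comment> \<open>Cutting each test at 1/2 turns it into an event. By Markov's inequality this
    costs a factor 2 in both error probabilities.\<close>
  define R where "R x = {y \<in> space \<mu>. 1/2 \<le> \<phi> x y}" for x
  have R[measurable]: "R x \<in> sets \<mu>" if "x \<in> X'" for x
    using \<phi>_meas[OF that] unfolding R_def by measurable
  define U where "U = (\<Union>x\<in>X'. R x)"
  have U[measurable]: "U \<in> sets \<mu>" using R \<open>finite X'\<close> by (auto simp: U_def)
  have type_I: "measure (law \<mu> (p \<eta>0)) (R x) \<le> 2 * q" if x: "x \<in> X'" for x
  proof -
    have "measure (law \<mu> (p \<eta>0)) {y \<in> space (law \<mu> (p \<eta>0)). 1/2 \<le> \<phi> x y}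
        \<le> (\<integral>y. \<phi> x y \<partial>law \<mu> (p \<eta>0)) / (1/2)"
      using \<phi>_range[OF x] \<phi>_integrable[OF \<eta>0 x]
      by (intro integral_Markov_inequality_measure[where A = "{}"] AE_I2) auto
    then show ?thesis using \<phi>(2)[OF x] by (simp add: R_def)
  qed
  have type_II: "measure (law \<mu> (p \<eta>)) (space \<mu> - R x) \<le> 2 * q"
    if x: "x \<in> X'" and \<eta>: "\<eta> \<in> S" "d \<eta> x < a * e" for x \<eta>
  proof -
    interpret Q: prob_space "law \<mu> (p \<eta>)" by (rule prob) fact
    \<comment> \<open>A real supremum dominates its members only if the family is bounded above;
      error probabilities are at most 1.\<close>
    have "(\<integral>y. (1 - \<phi> x y) \<partial>law \<mu> (p \<zeta>)) \<le> 1" if "\<zeta> \<in> S" for \<zeta>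
    proof -
      interpret Z: prob_space "law \<mu> (p \<zeta>)" by (rule prob) fact
      show ?thesis
        using \<phi>_range[OF x] \<phi>_integrable(2)[OF that x] by (intro Z.integral_le_const AE_I2) auto
    qed
    then have "bdd_above ((\<lambda>\<eta>. \<integral>y. (1 - \<phi> x y) \<partial>law \<mu> (p \<eta>)) ` {\<eta> \<in> S. d \<eta> x < a * e})"
      by (intro bdd_aboveI2[where M = 1]) auto
    then have "(\<integral>y. (1 - \<phi> x y) \<partial>law \<mu> (p \<eta>))
        \<le> (SUP \<eta>\<in>{\<eta>\<in>S. d \<eta> x < a * e}. \<integral>y. (1 - \<phi> x y) \<partial>law \<mu> (p \<eta>))"
      using \<eta> by (intro cSUP_upper) simp_all
    then have "(\<integral>y. (1 - \<phi> x y) \<partial>law \<mu> (p \<eta>)) \<le> q"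
      using \<phi>(3)[OF x] by (rule order_trans)
    moreover have "measure (law \<mu> (p \<eta>)) {y \<in> space (law \<mu> (p \<eta>)). 1/2 \<le> 1 - \<phi> x y}
        \<le> (\<integral>y. (1 - \<phi> x y) \<partial>law \<mu> (p \<eta>)) / (1/2)"
      using \<phi>_range[OF x] \<phi>_integrable[OF \<eta>(1) x]
      by (intro integral_Markov_inequality_measure[where A = "{}"] AE_I2) auto
    moreover have "measure (law \<mu> (p \<eta>)) (space \<mu> - R x)
        \<le> measure (law \<mu> (p \<eta>)) {y \<in> space (law \<mu> (p \<eta>)). 1/2 \<le> 1 - \<phi> x y}"
      using \<phi>_meas[OF x] by (intro Q.finite_measure_mono) (auto simp: R_def)
    ultimately show ?thesis by simp
  qed
  interpret P0: prob_space "law \<mu> (p \<eta>0)" by (rule prob) fact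
  have "measure (law \<mu> (p \<eta>0)) U \<le> (\<Sum>x\<in>X'. measure (law \<mu> (p \<eta>0)) (R x))"
    unfolding U_def using R \<open>finite X'\<close> by (intro P0.finite_measure_subadditive_finite) auto
  also have "\<dots> \<le> real (card X') * (2 * q)"
    using type_I by (intro sum_bounded_above) auto
  also have "\<dots> \<le> N * (2 * q)"
    using X(4) \<open>card X' \<le> card X\<close> \<open>0 \<le> q\<close> by (intro mult_right_mono) auto
  finally have U0: "measure (law \<mu> (p \<eta>0)) U \<le> 2 * N * q" by simp
  show thesis
  proof (rule that[OF U U0])
    fix \<eta> assume \<eta>: "\<eta> \<in> T" "d \<eta> \<eta>0 \<ge> e + r"
    then obtain x where x: "x \<in> X" "\<eta> \<in> mball x r" using X(3) by auto
    then have S: "x \<in> S" "\<eta> \<in> S" "d x \<eta> < r" by auto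
    have "d \<eta> \<eta>0 \<le> d \<eta> x + d x \<eta>0" using S \<eta>0 by (intro triangle) auto
    then have "d \<eta>0 x > e" using S \<eta>(2) by (simp add: commute)
    then have x': "x \<in> X'" using x by (simp add: X'_def)
    interpret Q: prob_space "law \<mu> (p \<eta>)" by (rule prob) fact
    have "measure (law \<mu> (p \<eta>)) (space \<mu> - U) \<le> measure (law \<mu> (p \<eta>)) (space \<mu> - R x)"
      using x' R[OF x'] by (intro Q.finite_measure_mono) (auto simp: U_def)
    also have "\<dots> \<le> 2 * q"
      using S r by (intro type_II[OF x']) (auto simp: commute)
    finally show "measure (law \<mu> (p \<eta>)) (space \<mu> - U) \<le> 2 * q" .
  qed
qed

section \<open>Posterior mass for a fixed sample size\<close>

text \<open>Dividing numerator and denominator by \<open>p \<eta>0 y powr \<alpha>\<close> expresses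
  the posterior through likelihood ratios. It exceeds \<open>\<delta>\<close> only on
  \<open>U\<close>, where the evidence is small, where the numerator is large outside
  \<open>U\<close>, or on a null set. The three terms bound the first three events; in the
  application \<open>T\<close> is the sieve and \<open>W\<close> the Kullback-Leibler
  neighbourhood.\<close>

lemma alpha_posterior_tail_bound:
  assumes model: "statistical_experiment S \<mu> p" and prior: "prior_for S \<mu> p \<pi>"
    and \<eta>0: "\<eta>0 \<in> S" and \<alpha>: "0 < \<alpha>" "\<alpha> \<le> 1"
    and B[measurable]: "B \<in> sets \<pi>" and T[measurable]: "T \<in> sets \<pi>" and W: "W \<in> sets \<pi>"
    and U[measurable]: "U \<in> sets \<mu>" and "0 < Q" "0 < t" "0 < \<delta>" "0 \<le> \<beta>"
    and W_pos: "0 < measure \<pi> W"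
    and power: "\<And>\<eta>. \<eta> \<in> B \<inter> T \<Longrightarrow> measure (law \<mu> (p \<eta>)) (space \<mu> - U) \<le> Q"
    and tail: "\<And>\<eta>. \<eta> \<in> W \<Longrightarrow>
      emeasure (law \<mu> (p \<eta>0)) {y \<in> space \<mu>. p \<eta> y / p \<eta>0 y < t} \<le> ennreal \<beta>"
  shows "measure (law \<mu> (p \<eta>0)) {y \<in> space (law \<mu> (p \<eta>0)). ennreal \<delta> < alpha_posterior \<alpha> \<pi> p y B}
    \<le> measure (law \<mu> (p \<eta>0)) U + 2 * \<beta>
      + 2 * (measure \<pi> (S - T) + Q powr \<alpha>) / (\<delta> * t powr \<alpha> * measure \<pi> W)"
proof -
  define P where "P = law \<mu> (p \<eta>0)"
  have prob: "prob_space (law \<mu> (p \<eta>))" and dens[measurable]: "p \<eta> \<in> borel_measurable \<mu>"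
    and nonneg: "\<And>y. y \<in> space \<mu> \<Longrightarrow> 0 \<le> p \<eta> y" if "\<eta> \<in> S" for \<eta>
    using model that by (auto simp: statistical_experiment_def)
  have [measurable]: "p \<eta>0 \<in> borel_measurable \<mu>" using \<eta>0 by (rule dens)
  have sets_P[measurable_cong]: "sets P = sets \<mu>" and space_P: "space P = space \<mu>"
    by (simp_all add: P_def)
  interpret P: prob_space P unfolding P_def by (rule prob) fact
  interpret \<pi>: prob_space \<pi> using prior by (simp add: prior_for_def)
  interpret pair_sigma_finite \<pi> P ..
  have space_\<pi>: "space \<pi> = S" using prior by (simp add: prior_for_def)
  have [measurable]: "(\<lambda>(\<eta>, y). p \<eta> y) \<in> borel_measurable (\<pi> \<Otimes>\<^sub>M \<mu>)"
    using prior by (simp add: prior_for_def)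
  define u where "u \<eta> y = p \<eta> y / p \<eta>0 y" for \<eta> y
  have u[measurable]: "case_prod u \<in> borel_measurable (\<pi> \<Otimes>\<^sub>M P)"
    unfolding u_def by measurable
  have u_slice[measurable]: "(\<lambda>\<eta>. u \<eta> y) \<in> borel_measurable \<pi>" if "y \<in> space P" for y
    using measurable_Pair1[OF u that] by simp
  obtain G where G[measurable]: "G \<in> sets P" and PG: "emeasure P G \<le> ennreal (2 * \<beta>)"
    and evidence: "\<And>y. y \<in> space P - G \<Longrightarrow>
      ennreal (t powr \<alpha> * measure \<pi> W / 2) \<le> (\<integral>\<^sup>+\<eta>. ennreal (u \<eta> y powr \<alpha>) \<partial>\<pi>)"
    using evidence_lower_bound[OF P.prob_space_axioms \<pi>.prob_space_axioms u W W_pos \<open>0 \<le> \<beta>\<close> \<open>0 < t\<close> \<open>0 < \<alpha>\<close>] tail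
    by (auto simp: P_def u_def)
  define c where "c = t powr \<alpha> * measure \<pi> W / 2"
  have "0 < c" using \<open>0 < t\<close> W_pos by (simp add: c_def)
  define num where "num y = (\<integral>\<^sup>+\<eta>\<in>B. ennreal (u \<eta> y powr \<alpha>) \<partial>\<pi>)" for y
  define V where "V = space \<mu> - U"
  have V[measurable]: "V \<in> sets \<mu>" by (auto simp: V_def)
  \<comment> \<open>The numerator's integrand cut off on \<open>U\<close>, in a jointly measurable
    form to which Fubini applies.\<close>
  define w where "w \<eta> y = ennreal (u \<eta> y powr \<alpha>) * indicator B \<eta> * indicator V y" for \<eta> y
  have w[measurable]: "case_prod w \<in> borel_measurable (\<pi> \<Otimes>\<^sub>M P)"
    unfolding w_def by measurable
  have num_V: "num y * indicator V y = (\<integral>\<^sup>+\<eta>. w \<eta> y \<partial>\<pi>)" if "y \<in> space P" for y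
    using that by (simp add: num_def w_def nn_integral_multc)
  have [measurable]: "num \<in> borel_measurable P"
  proof -
    have "(\<lambda>(\<eta>, y). ennreal (u \<eta> y powr \<alpha>) * indicator B \<eta>) \<in> borel_measurable (\<pi> \<Otimes>\<^sub>M P)"
      by measurable
    from measurable_pair_swap[OF this] show ?thesis
      unfolding num_def by (intro \<pi>.borel_measurable_nn_integral) (simp add: case_prod_beta')
  qed
  have slice: "(\<integral>\<^sup>+y. w \<eta> y \<partial>P) \<le> ennreal (Q powr \<alpha>) * indicator (space \<pi>) \<eta> + indicator (S - T) \<eta>"
    if "\<eta> \<in> space \<pi>" for \<eta>
  proof -
    have "\<eta> \<in> S" using that by (simp add: space_\<pi>)
    interpret Q: prob_space "law \<mu> (p \<eta>)" by (rule prob) fact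
    \<comment> \<open>Used twice: with \<open>R = Q\<close> on the sieve, where the tests have
      power, and with the trivial \<open>R = 1\<close> off the sieve, which therefore enters only
      through its prior mass.\<close>
    have *: "(\<integral>\<^sup>+y. w \<eta> y \<partial>P) \<le> ennreal (R powr \<alpha>)"
      if "0 < R" "emeasure (law \<mu> (p \<eta>)) V \<le> ennreal R" for R
    proof -
      have "(\<integral>\<^sup>+y. w \<eta> y \<partial>P) \<le> (\<integral>\<^sup>+y\<in>V. ennreal ((p \<eta> y / p \<eta>0 y) powr \<alpha>) \<partial>P)"
        by (intro nn_integral_mono) (auto simp: w_def u_def split: split_indicator)
      also have "\<dots> \<le> ennreal (R powr \<alpha>)"
        unfolding P_def using \<eta>0 \<open>\<eta> \<in> S\<close> that \<alpha>
        by (intro nn_integral_likelihood_ratio_powr_le dens nonneg prob V) auto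
      finally show ?thesis .
    qed
    consider "\<eta> \<notin> B" | "\<eta> \<in> B" "\<eta> \<in> T" | "\<eta> \<notin> T" by blast
    then show ?thesis
    proof cases
      case 1
      then show ?thesis by (simp add: w_def)
    next
      case 2
      then have "(\<integral>\<^sup>+y. w \<eta> y \<partial>P) \<le> ennreal (Q powr \<alpha>)"
        using power[of \<eta>] \<open>0 < Q\<close> by (intro *) (auto simp: V_def Q.emeasure_eq_measure)
      then show ?thesis using that 2 by simp
    next
      case 3
      have "(\<integral>\<^sup>+y. w \<eta> y \<partial>P) \<le> 1"
        using *[of 1] Q.emeasure_le_1 by simp
      then show ?thesis using that 3 \<open>\<eta> \<in> S\<close> by (simp add: add_increasing)
    qed
  qed
  have "S - T \<in> sets \<pi>" using space_\<pi> T by auto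
  have "(\<integral>\<^sup>+y. num y * indicator V y \<partial>P) = (\<integral>\<^sup>+y. (\<integral>\<^sup>+\<eta>. w \<eta> y \<partial>\<pi>) \<partial>P)"
    by (intro nn_integral_cong num_V)
  also have "\<dots> = (\<integral>\<^sup>+\<eta>. (\<integral>\<^sup>+y. w \<eta> y \<partial>P) \<partial>\<pi>)"
    using Fubini'[OF w] by simp
  also have "\<dots> \<le> (\<integral>\<^sup>+\<eta>. ennreal (Q powr \<alpha>) * indicator (space \<pi>) \<eta> + indicator (S - T) \<eta> \<partial>\<pi>)"
    by (intro nn_integral_mono slice)
  also have "\<dots> = ennreal (Q powr \<alpha> + measure \<pi> (S - T))"
    using \<open>S - T \<in> sets \<pi>\<close>
    by (simp add: nn_integral_add nn_integral_cmult_indicator \<pi>.emeasure_eq_measure \<pi>.prob_space)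
  finally have num_le: "(\<integral>\<^sup>+y. num y * indicator V y \<partial>P) \<le> ennreal (Q powr \<alpha> + measure \<pi> (S - T))" .
  \<comment> \<open>The observations outside \<open>U\<close> at which the numerator is at least
    \<open>\<delta> * c\<close>, where \<open>c\<close> is the lower bound for the evidence off
    \<open>G\<close>.\<close>
  define F where "F = {y \<in> V. 1 \<le> ennreal (1 / (\<delta> * c)) * num y}"
  have "F = {y \<in> space P. y \<in> V \<and> 1 \<le> ennreal (1 / (\<delta> * c)) * num y}"
    by (auto simp: F_def V_def space_P)
  also have "\<dots> \<in> sets P" by measurable
  finally have F: "F \<in> sets P" .
  have "emeasure P F \<le> ennreal (1 / (\<delta> * c)) * (\<integral>\<^sup>+y. num y * indicator V y \<partial>P)"
    unfolding F_def by (intro nn_integral_Markov_inequality) (auto simp: sets_P)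
  also have "\<dots> \<le> ennreal (1 / (\<delta> * c)) * ennreal (Q powr \<alpha> + measure \<pi> (S - T))"
    by (intro mult_left_mono num_le) simp
  also have "\<dots> = ennreal ((Q powr \<alpha> + measure \<pi> (S - T)) / (\<delta> * c))"
    using \<open>0 < \<delta>\<close> \<open>0 < c\<close> by (simp del: ennreal_plus flip: ennreal_mult)
  finally have PF: "measure P F \<le> (Q powr \<alpha> + measure \<pi> (S - T)) / (\<delta> * c)"
    using \<open>0 < \<delta>\<close> \<open>0 < c\<close> by (simp add: P.emeasure_eq_measure)
  \<comment> \<open>Where the true density is 0, \<open>u\<close> takes the default value 0 of
    division and the factor \<open>k\<close> below cannot be split off; this set is null under the
    truth.\<close>
  define Z where "Z = {y \<in> space P. p \<eta>0 y = 0}"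
  have Z[measurable]: "Z \<in> sets P" unfolding Z_def by measurable
  have "emeasure P Z = (\<integral>\<^sup>+y. ennreal (p \<eta>0 y) * indicator Z y \<partial>\<mu>)"
    using Z unfolding P_def by (intro emeasure_density) (auto simp: sets_P)
  also have "\<dots> = (\<integral>\<^sup>+y. 0 \<partial>\<mu>)"
    by (intro nn_integral_cong) (auto simp: Z_def split: split_indicator)
  finally have PZ: "measure P Z = 0" by (simp add: measure_def)
  have "{y \<in> space P. ennreal \<delta> < alpha_posterior \<alpha> \<pi> p y B} \<subseteq> ((U \<union> G) \<union> F) \<union> Z"
  proof (rule subsetI, rule ccontr)
    fix y assume y: "y \<in> {y \<in> space P. ennreal \<delta> < alpha_posterior \<alpha> \<pi> p y B}" "y \<notin> ((U \<union> G) \<union> F) \<union> Z"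
    then have "y \<in> space \<mu>" "y \<in> V" by (auto simp: V_def space_P)
    then have "0 < p \<eta>0 y" using y nonneg[OF \<eta>0, of y] by (auto simp: Z_def space_P)
    define k where "k = ennreal (p \<eta>0 y powr \<alpha>)"
    define den where "den = (\<integral>\<^sup>+\<eta>. ennreal (u \<eta> y powr \<alpha>) \<partial>\<pi>)"
    have [measurable]: "(\<lambda>\<eta>. u \<eta> y) \<in> borel_measurable \<pi>" using y by (intro u_slice) auto
    have split: "ennreal (p \<eta> y powr \<alpha>) = k * ennreal (u \<eta> y powr \<alpha>)" if "\<eta> \<in> space \<pi>" for \<eta>
      using that \<open>0 < p \<eta>0 y\<close> nonneg[of \<eta> y] \<open>y \<in> space \<mu>\<close>
      by (simp add: k_def u_def space_\<pi> powr_divide flip: ennreal_mult)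
    have "(\<integral>\<^sup>+\<eta>\<in>B. ennreal (p \<eta> y powr \<alpha>) \<partial>\<pi>) = k * num y"
      unfolding num_def by (subst nn_integral_cmult[symmetric]) (auto intro!: nn_integral_cong simp: split mult.assoc)
    moreover have "(\<integral>\<^sup>+\<eta>. ennreal (p \<eta> y powr \<alpha>) \<partial>\<pi>) = k * den"
      unfolding den_def by (subst nn_integral_cmult[symmetric]) (auto intro!: nn_integral_cong simp: split)
    ultimately have post: "alpha_posterior \<alpha> \<pi> p y B = k * num y / (k * den)"
      by (simp add: alpha_posterior_def)
    have den: "ennreal c \<le> den" using evidence[of y] y by (simp add: c_def den_def)
    have "ennreal (1 / (\<delta> * c)) * num y < 1" using y \<open>y \<in> V\<close> by (auto simp: F_def not_le)
    then have "ennreal (\<delta> * c) * (ennreal (1 / (\<delta> * c)) * num y) \<le> ennreal (\<delta> * c) * 1"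
      by (intro mult_left_mono) auto
    then have "num y \<le> ennreal (\<delta> * c)"
      using \<open>0 < \<delta>\<close> \<open>0 < c\<close> by (simp add: mult.assoc[symmetric] flip: ennreal_mult)
    also have "\<dots> \<le> ennreal \<delta> * den"
      using den \<open>0 < \<delta>\<close> \<open>0 < c\<close> by (simp add: ennreal_mult mult_left_mono)
    finally have "k * num y \<le> k * (ennreal \<delta> * den)" by (intro mult_left_mono) auto
    \<comment> \<open>The common factor \<open>k\<close> is carried along. Division in
      \<open>ennreal\<close> by a positive quantity respects the bound even if that quantity is
      infinite.\<close>
    moreover have "0 < k * den"
      using den \<open>0 < c\<close> \<open>0 < p \<eta>0 y\<close>
      by (auto simp: k_def ennreal_zero_less_mult_iff intro: less_le_trans[of 0 "ennreal c"])
    ultimately have "alpha_posterior \<alpha> \<pi> p y B \<le> ennreal \<delta>"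
      unfolding post by (intro divide_le_posI_ennreal) (auto simp: mult_ac)
    then show False using y by (auto simp: not_le[symmetric])
  qed
  then have "measure P {y \<in> space P. ennreal \<delta> < alpha_posterior \<alpha> \<pi> p y B} \<le> measure P (((U \<union> G) \<union> F) \<union> Z)"
    using F by (intro P.finite_measure_mono) auto
  also have "\<dots> \<le> measure P ((U \<union> G) \<union> F) + measure P Z"
    using F by (intro measure_Un_le) auto
  also have "\<dots> \<le> measure P (U \<union> G) + measure P F + measure P Z"
    using F by (intro add_right_mono measure_Un_le) auto
  also have "\<dots> \<le> measure P U + measure P G + measure P F + measure P Z"
    by (intro add_right_mono measure_Un_le) auto
  also have "\<dots> \<le> measure P U + 2 * \<beta> + (Q powr \<alpha> + measure \<pi> (S - T)) / (\<delta> * c) + 0"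
    using PG PF PZ \<open>0 \<le> \<beta>\<close> by (intro add_mono) (auto simp: P.emeasure_eq_measure)
  finally show ?thesis
    by (simp add: P_def c_def algebra_simps)
qed

section \<open>Choice of constants and passage to the limit\<close>

theorem theorem4p3:
  fixes S :: "'p set" and d :: "'p \<Rightarrow> 'p \<Rightarrow> real" and \<eta>0 :: 'p
    and \<mu> :: "nat \<Rightarrow> 'y measure" and p :: "nat \<Rightarrow> 'p \<Rightarrow> 'y \<Rightarrow> real"
    and \<pi> :: "nat \<Rightarrow> 'p measure"
    and \<epsilon> \<epsilon>' \<alpha> :: "nat \<Rightarrow> real" and S' :: "nat \<Rightarrow> 'p set"
    and K a C D :: real
  assumes densities: "\<And>n. n \<ge> 1 \<Longrightarrow> statistical_experiment S (\<mu> n) (p n)"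
    and metric: "Metric_space S d"
    and true_parameter: "\<eta>0 \<in> S"
    and test_constants: "K > 0" "a > 0"
    and tests: "\<And>e \<eta>1. \<lbrakk>e > 0; \<eta>1 \<in> S; d \<eta>0 \<eta>1 > e\<rbrakk> \<Longrightarrow>
      \<exists>\<phi> :: nat \<Rightarrow> 'y \<Rightarrow> real. \<forall>n\<ge>1. is_test (\<mu> n) (\<phi> n) \<and>
        (\<integral>y. \<phi> n y \<partial>law (\<mu> n) (p n \<eta>0)) \<le> exp (- (K * real n * e\<^sup>2)) \<and>
        (SUP \<eta>\<in>{\<eta>\<in>S. d \<eta> \<eta>1 < a * e}. \<integral>y. (1 - \<phi> n y) \<partial>law (\<mu> n) (p n \<eta>))
          \<le> exp (- (K * real n * e\<^sup>2))"
    and prior: "\<And>n. n \<ge> 1 \<Longrightarrow> prior_for S (\<mu> n) (p n) (\<pi> n)"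
    and dist_measurable: "\<And>n. n \<ge> 1 \<Longrightarrow> (\<lambda>\<eta>. d \<eta> \<eta>0) \<in> borel_measurable (\<pi> n)"
    and rates: "\<And>n. n \<ge> 1 \<Longrightarrow> 0 \<le> \<epsilon> n" "\<And>n. n \<ge> 1 \<Longrightarrow> 0 \<le> \<epsilon>' n"
    and alpha: "\<And>n. n \<ge> 1 \<Longrightarrow> 0 < \<alpha> n" "\<And>n. n \<ge> 1 \<Longrightarrow> \<alpha> n \<le> 1"
    and rate_infinity: "filterlim (\<lambda>n. real n * \<alpha> n * (\<epsilon>' n)\<^sup>2) at_top sequentially"
    and prior_constants: "C > 0" "D > 0"
    and sieve: "\<And>n. n \<ge> 1 \<Longrightarrow> S' n \<in> sets (\<pi> n)"
    and entropy: "\<And>n. n \<ge> 1 \<Longrightarrow>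
      ereal_of_enat (covering_number S d (\<epsilon> n) (S' n)) \<le> ereal (exp (D * real n * (\<epsilon> n)\<^sup>2))"
    and remaining_mass: "\<And>n. n \<ge> 1 \<Longrightarrow>
      measure (\<pi> n) (S - S' n) \<le> exp (- ((C + 3) * real n * \<alpha> n * (\<epsilon>' n)\<^sup>2))"
    and prior_mass: "\<And>n. n \<ge> 1 \<Longrightarrow>
      measure (\<pi> n) (KL_nbhd S (\<mu> n) (p n) n \<eta>0 (\<epsilon>' n)) \<ge> exp (- (C * real n * \<alpha> n * (\<epsilon>' n)\<^sup>2))"
  shows "\<exists>M>0. tendsto_zero_in_prob (\<lambda>n. law (\<mu> n) (p n \<eta>0))
    (\<lambda>n y. alpha_posterior (\<alpha> n) (\<pi> n) (p n) y {\<eta>\<in>S. d \<eta> \<eta>0 \<ge> M * max (\<epsilon> n) (\<epsilon>' n)})"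
proof -
  \<comment> \<open>The term \<open>1 / a\<close> makes the balls small enough for the tests, since
    then \<open>a * b \<ge> 1\<close>. The 1 gives \<open>b \<le> b\<^sup>2\<close>. The last term
    makes \<open>K * b\<^sup>2\<close> exceed both \<open>D + 1\<close>, to beat the entropy, and
    \<open>C + 3\<close>, to beat the evidence.\<close>
  define b where "b = 1 / a + 1 + (D + C + 3) / K"
  have "1 \<le> b" and b: "1 / a \<le> b" "(D + C + 3) / K \<le> b"
    using test_constants prior_constants by (auto simp: b_def field_simps add_pos_pos)
  have "1 \<le> a * b" using b(1) test_constants by (simp add: field_simps)
  have "D + C + 3 \<le> K * b" using b(2) test_constants by (simp add: field_simps)
  also have "\<dots> \<le> K * b\<^sup>2"
    using \<open>1 \<le> b\<close> test_constants self_le_power[of b 2] by (intro mult_left_mono) auto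
  finally have Kb: "D + 1 \<le> K * b\<^sup>2" "C + 3 \<le> K * b\<^sup>2" using prior_constants by auto
  \<comment> \<open>The additional 1 pays for the covering radius: \<open>M * r = e + r\<close>,
    which is at least \<open>e + \<epsilon> n\<close>.\<close>
  define M where "M = b + 1"
  define s where "s n = real n * \<alpha> n * (\<epsilon>' n)\<^sup>2" for n
  have s_lim: "filterlim s at_top sequentially" using rate_infinity by (simp add: s_def[abs_def])
  define B where "B n = {\<eta>\<in>S. d \<eta> \<eta>0 \<ge> M * max (\<epsilon> n) (\<epsilon>' n)}" for n
  have bound: "measure (law (\<mu> n) (p n \<eta>0))
      {y \<in> space (law (\<mu> n) (p n \<eta>0)). ennreal \<delta> < alpha_posterior (\<alpha> n) (\<pi> n) (p n) y (B n)}
      \<le> 2 * exp (- s n) + 2 * (1 / s n) + 6 / \<delta> * exp (- s n)"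
    if "0 < \<delta>" and n: "n \<ge> 1" and "0 < s n" for \<delta> n
  proof -
    define r where "r = max (\<epsilon> n) (\<epsilon>' n)"
    define t where "t = real n * (\<epsilon>' n)\<^sup>2"
    define e where "e = b * r"
    define q where "q = exp (- (K * real n * e\<^sup>2))"
    define W where "W = KL_nbhd S (\<mu> n) (p n) n \<eta>0 (\<epsilon>' n)"
    note \<alpha> = alpha[OF n]
    have \<epsilon>: "0 \<le> \<epsilon> n" "0 \<le> \<epsilon>' n" using rates n by auto
    have "\<epsilon>' n \<noteq> 0" using \<open>0 < s n\<close> by (auto simp: s_def)
    then have "0 < \<epsilon>' n" using \<epsilon> by simp
    then have "0 < r" by (simp add: r_def less_max_iff_disj)
    have "0 < t" using \<open>0 < \<epsilon>' n\<close> n by (simp add: t_def)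
    have s_eq: "s n = \<alpha> n * t" by (simp add: s_def t_def)
    have "s n \<le> t" using \<alpha> \<open>0 < t\<close> by (simp add: s_eq mult_left_le_one_le)
    have "t \<le> real n * r\<^sup>2"
      unfolding t_def r_def using \<epsilon> by (intro mult_left_mono power_mono) auto
    have "0 < e" using \<open>1 \<le> b\<close> \<open>0 < r\<close> by (simp add: e_def)
    have e: "K * real n * e\<^sup>2 = K * b\<^sup>2 * (real n * r\<^sup>2)" by (simp add: e_def power_mult_distrib)
    have model: "statistical_experiment S (\<mu> n) (p n)" using densities n by simp
    have "\<epsilon> n \<le> r" by (simp add: r_def)
    also have "r \<le> a * e" using \<open>1 \<le> a * b\<close> \<open>0 < r\<close> mult_right_mono[of 1 "a * b" r] by (simp add: e_def mult.assoc)
    finally have "\<epsilon> n \<le> a * e" .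
    \<comment> \<open>The cover has radius \<open>\<epsilon> n\<close>, the scale at which the
      entropy is controlled, whereas the separation \<open>e\<close> is a multiple of the larger
      rate \<open>r\<close>.\<close>
    obtain U where U: "U \<in> sets (\<mu> n)"
      and U0: "measure (law (\<mu> n) (p n \<eta>0)) U \<le> 2 * exp (D * real n * (\<epsilon> n)\<^sup>2) * q"
      and U1: "\<And>\<eta>. \<lbrakk>\<eta> \<in> S' n; d \<eta> \<eta>0 \<ge> e + \<epsilon> n\<rbrakk> \<Longrightarrow>
        measure (law (\<mu> n) (p n \<eta>)) (space (\<mu> n) - U) \<le> 2 * q"
    proof (rule separating_event[OF model metric true_parameter \<open>0 < e\<close> test_constants(2) \<open>\<epsilon> n \<le> a * e\<close> _ _ entropy[OF n]])
      show "0 \<le> q" by (simp add: q_def)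
      show "\<exists>\<phi>. is_test (\<mu> n) \<phi> \<and> (\<integral>y. \<phi> y \<partial>law (\<mu> n) (p n \<eta>0)) \<le> q \<and>
          (SUP \<eta>\<in>{\<eta>\<in>S. d \<eta> \<eta>1 < a * e}. \<integral>y. (1 - \<phi> y) \<partial>law (\<mu> n) (p n \<eta>)) \<le> q"
        if "\<eta>1 \<in> S" "d \<eta>0 \<eta>1 > e" for \<eta>1
        using tests[OF \<open>0 < e\<close> that] n unfolding q_def by blast
    qed (rule that)
    \<comment> \<open>Entropy against type I error: the exponent
      \<open>D + 1 - K * b\<^sup>2\<close> is nonpositive, which leaves
      \<open>- real n * r\<^sup>2 \<le> - t \<le> - s n\<close>.\<close>
    have "D * real n * (\<epsilon> n)\<^sup>2 \<le> D * (real n * r\<^sup>2)"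
      unfolding mult.assoc r_def using prior_constants \<epsilon> by (intro mult_left_mono power_mono) auto
    moreover have "(D + 1) * (real n * r\<^sup>2) \<le> K * b\<^sup>2 * (real n * r\<^sup>2)"
      using Kb by (intro mult_right_mono) auto
    ultimately have "D * real n * (\<epsilon> n)\<^sup>2 - K * real n * e\<^sup>2 \<le> - s n"
      using \<open>s n \<le> t\<close> \<open>t \<le> real n * r\<^sup>2\<close> unfolding e by (simp add: distrib_right)
    then have "2 * exp (D * real n * (\<epsilon> n)\<^sup>2) * q \<le> 2 * exp (- s n)"
      by (simp add: q_def flip: exp_add)
    with U0 have type_I: "measure (law (\<mu> n) (p n \<eta>0)) U \<le> 2 * exp (- s n)" by simp
    \<comment> \<open>The tests work at rate \<open>t\<close>; raising to the power
      \<open>\<alpha> n\<close> turns this into \<open>s n\<close>, the rate in the prior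
      conditions.\<close>
    have "(C + 3) * t \<le> K * b\<^sup>2 * (real n * r\<^sup>2)"
      using Kb \<open>t \<le> real n * r\<^sup>2\<close> \<open>0 < t\<close> prior_constants by (intro mult_mono) auto
    then have "\<alpha> n * ((C + 3) * t) \<le> \<alpha> n * (K * real n * e\<^sup>2)"
      unfolding e using \<alpha> by (intro mult_left_mono) auto
    then have q: "q powr \<alpha> n \<le> exp (- ((C + 3) * s n))"
      by (simp add: q_def s_eq powr_def mult_ac)
    have "(2 * q) powr \<alpha> n = 2 powr \<alpha> n * q powr \<alpha> n" by (simp add: powr_mult q_def)
    also have "\<dots> \<le> 2 * exp (- ((C + 3) * s n))"
      using q \<alpha> powr_mono[of "\<alpha> n" 1 2] by (intro mult_mono) auto
    finally have power_le: "(2 * q) powr \<alpha> n \<le> 2 * exp (- ((C + 3) * s n))" .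
    have rem: "measure (\<pi> n) (S - S' n) \<le> exp (- ((C + 3) * s n))"
      using remaining_mass[OF n] by (simp add: s_def mult.assoc)
    have mass: "exp (- (C * s n)) \<le> measure (\<pi> n) W"
      using prior_mass[OF n] by (simp add: s_def mult.assoc W_def)
    then have W_pos: "0 < measure (\<pi> n) W" by (rule less_le_trans[rotated]) simp
    \<comment> \<open>A non-measurable set has measure 0.\<close>
    then have W: "W \<in> sets (\<pi> n)" by (metis less_irrefl measure_notin_sets)
    have space_\<pi>: "space (\<pi> n) = S" using prior[OF n] by (simp add: prior_for_def)
    have [measurable]: "(\<lambda>\<eta>. d \<eta> \<eta>0) \<in> borel_measurable (\<pi> n)" using dist_measurable n by simp
    have "{\<eta>\<in>space (\<pi> n). d \<eta> \<eta>0 \<ge> M * max (\<epsilon> n) (\<epsilon>' n)} \<in> sets (\<pi> n)" by measurable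
    then have B: "B n \<in> sets (\<pi> n)" by (simp add: B_def space_\<pi>)
    have dens: "p n \<eta> \<in> borel_measurable (\<mu> n)" "\<And>y. y \<in> space (\<mu> n) \<Longrightarrow> 0 \<le> p n \<eta> y" if "\<eta> \<in> S" for \<eta>
      using model that by (auto simp: statistical_experiment_def)
    have "measure (law (\<mu> n) (p n \<eta>0))
      {y \<in> space (law (\<mu> n) (p n \<eta>0)). ennreal \<delta> < alpha_posterior (\<alpha> n) (\<pi> n) (p n) y (B n)}
      \<le> measure (law (\<mu> n) (p n \<eta>0)) U + 2 * (1 / t) + 2 * (measure (\<pi> n) (S - S' n) + (2 * q) powr \<alpha> n)
         / (\<delta> * exp (- (2 * t)) powr \<alpha> n * measure (\<pi> n) W)"
    proof (rule alpha_posterior_tail_bound[OF model prior[OF n] true_parameter \<alpha> B sieve[OF n] W U])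
      show "measure (law (\<mu> n) (p n \<eta>)) (space (\<mu> n) - U) \<le> 2 * q" if "\<eta> \<in> B n \<inter> S' n" for \<eta>
        using that \<open>\<epsilon> n \<le> r\<close> by (intro U1) (auto simp: B_def M_def e_def distrib_right simp flip: r_def)
      show "emeasure (law (\<mu> n) (p n \<eta>0)) {y \<in> space (\<mu> n). p n \<eta> y / p n \<eta>0 y < exp (- (2 * t))} \<le> ennreal (1 / t)"
        if "\<eta> \<in> W" for \<eta>
        using that dens true_parameter \<open>0 < t\<close>
        by (intro KL_lower_tail) (auto simp: W_def KL_nbhd_def t_def)
    qed (use \<open>0 < t\<close> \<open>0 < \<delta>\<close> W_pos in \<open>auto simp: q_def\<close>)
    also have "\<dots> \<le> 2 * exp (- s n) + 2 * (1 / s n) + 6 / \<delta> * exp (- s n)"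
    proof (intro add_mono type_I)
      show "2 * (1 / t) \<le> 2 * (1 / s n)"
        using \<open>s n \<le> t\<close> \<open>0 < s n\<close> by (simp add: frac_le)
      \<comment> \<open>The evidence is of order \<open>exp (- (C + 2) * s n)\<close>: 2 from the
        Chebyshev threshold and \<open>C\<close> from the prior mass. Against
        \<open>exp (- (C + 3) * s n)\<close> in the numerator one factor \<open>exp (- s n)\<close>
        survives. The 3 below is 1 for the sieve remainder plus 2 for the test errors.\<close>
      have t_powr: "exp (- (2 * t)) powr \<alpha> n = exp (- (2 * s n))"
        by (simp add: powr_def s_eq)
      have "2 * (measure (\<pi> n) (S - S' n) + (2 * q) powr \<alpha> n)
          / (\<delta> * exp (- (2 * t)) powr \<alpha> n * measure (\<pi> n) W)
          \<le> 2 * (3 * exp (- ((C + 3) * s n))) / (\<delta> * exp (- (2 * s n)) * exp (- (C * s n)))"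
        unfolding t_powr using power_le rem mass \<open>0 < \<delta>\<close> by (intro frac_le mult_left_mono) auto
      also have "\<dots> = 6 / \<delta> * (exp (- ((C + 3) * s n)) / exp (- (2 * s n) - C * s n))"
        by (simp add: exp_diff exp_minus field_simps)
      also have "exp (- ((C + 3) * s n)) / exp (- (2 * s n) - C * s n) = exp (- s n)"
        by (simp flip: exp_diff) (simp add: algebra_simps)
      finally show "2 * (measure (\<pi> n) (S - S' n) + (2 * q) powr \<alpha> n)
          / (\<delta> * exp (- (2 * t)) powr \<alpha> n * measure (\<pi> n) W) \<le> 6 / \<delta> * exp (- s n)" .
    qed
    finally show ?thesis .
  qed
  have "tendsto_zero_in_prob (\<lambda>n. law (\<mu> n) (p n \<eta>0)) (\<lambda>n y. alpha_posterior (\<alpha> n) (\<pi> n) (p n) y (B n))"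
    unfolding tendsto_zero_in_prob_def
  proof (intro allI impI)
    fix \<delta> :: real assume "0 < \<delta>"
    \<comment> \<open>The bound depends on \<open>n\<close> only through \<open>s n\<close>, so its
      limit is taken in a real variable and composed with \<open>s\<close>.\<close>
    have "((\<lambda>x::real. 2 * exp (- x) + 2 * (1 / x) + 6 / \<delta> * exp (- x)) \<longlongrightarrow> 2 * 0 + 2 * 0 + 6 / \<delta> * 0) at_top"
      by (intro tendsto_intros tendsto_divide_0[OF tendsto_const] filterlim_at_top_imp_at_infinity
          filterlim_ident filterlim_compose[OF exp_at_bot filterlim_uminus_at_bot_at_top])
    then have "(\<lambda>n. 2 * exp (- s n) + 2 * (1 / s n) + 6 / \<delta> * exp (- s n)) \<longlonglongrightarrow> 0"
      using s_lim by (auto intro: filterlim_compose)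
    then show "(\<lambda>n. measure (law (\<mu> n) (p n \<eta>0)) {y \<in> space (law (\<mu> n) (p n \<eta>0)).
        ennreal \<delta> < alpha_posterior (\<alpha> n) (\<pi> n) (p n) y (B n)}) \<longlonglongrightarrow> 0"
    proof (rule tendsto_sandwich[rotated 2, OF tendsto_const])
      show "\<forall>\<^sub>F n in sequentially. measure (law (\<mu> n) (p n \<eta>0)) {y \<in> space (law (\<mu> n) (p n \<eta>0)).
        ennreal \<delta> < alpha_posterior (\<alpha> n) (\<pi> n) (p n) y (B n)}
        \<le> 2 * exp (- s n) + 2 * (1 / s n) + 6 / \<delta> * exp (- s n)"
        using eventually_ge_at_top[of 1] filterlim_at_top_dense[THEN iffD1, OF s_lim, rule_format, of 0]
        by eventually_elim (rule bound[OF \<open>0 < \<delta>\<close>])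
    qed simp
  qed
  moreover have "0 < M" using \<open>1 \<le> b\<close> by (simp add: M_def)
  ultimately show ?thesis unfolding B_def by blast
qed

end
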